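(* Let $A\in\mathbb{R}^{n\times n}$ and let $\mathcal{P}\subseteq\mathbb{R}^n$ be a polyhedron. Assume that $\mathcal{P}$ is an invariant set for the continuous system $\dot{x}(t)=Ax(t)$. Then there exists $\hat\tau>0$ such that for every $x_k\in\mathcal{P}$ and every $\Delta t\in[0,\hat\tau]$, we have $x_{k+1}\in\mathcal{P}$, where $x_{k+1}=(I+\Delta t A)x_k$ is obtained by the forward Euler method; i.e., $\mathcal{P}$ is an invariant set for the discrete system $x_{k+1}=(I+\Delta t A)x_k$ for every such $\Delta t$.
   Context: A polyhedron is a set of the form $\mathcal{P}=\{x\in\mathbb{R}^n : Gx\le b\}$ with $G\in\mathbb{R}^{m\times n}$, $b\in\mathbb{R}^m$ (componentwise inequality). Equivalently, it is the set of all $\sum_{i=1}^{\ell_1}\theta_i x^i+\sum_{j=1}^{\ell_2}\hat\theta_j\hat x^j$ with $\theta_i\ge0$, $\sum_i\theta_i=1$, $\hat\theta_j\ge0$, for given vectors $x^i,\hat x^j\in\mathbb{R}^n$. A set $\mathcal{S}$ is an invariant set for $\dot x(t)=Ax(t)$ if $x(0)\in\mathcal{S}$ implies $x(t)\in\mathcal{S}$ for all $t\ge0$. It is an invariant set for a discrete system $x_{k+1}=Mx_k$ if $x_k\in\mathcal{S}$ implies $x_{k+1}\in\mathcal{S}$ for all $k\in\mathbb{N}$. *)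

theory Defs
  imports "HOL-Analysis.Analysis"
begin

text \<open>
  Polyhedra are the library's \<^const>\<open>polyhedron\<close>: finite intersections of half-spaces
  with nonzero normals. The lemma below shows that these are exactly the sets
  \<open>{x. G x \<le> b}\<close> with \<open>m\<close> rows \<open>g i\<close>, where zero rows and \<open>m = 0\<close> are allowed.
\<close>

lemma polyhedron_inequalities:
  fixes P :: "(real^'n) set"
  shows "polyhedron P \<longleftrightarrow>
    (\<exists>(m::nat) (g :: nat \<Rightarrow> real^'n) (b :: nat \<Rightarrow> real). P = {x. \<forall>i<m. g i \<bullet> x \<le> b i})"
proof
  assume "polyhedron P"
  then obtain F where F: "finite F" "P = \<Inter>F"
      "\<forall>h\<in>F. \<exists>a b. a \<noteq> 0 \<and> h = {x. a \<bullet> x \<le> b}"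
    unfolding polyhedron_def by auto
  obtain m f where F_eq: "F = f ` {i::nat. i < m}"
    using finite_imp_nat_seg_image_inj_on[OF F(1)] by blast
  have "\<forall>i. \<exists>a b. i < m \<longrightarrow> f i = {x. a \<bullet> x \<le> b}"
    using F(3) F_eq by blast
  then obtain g b where "\<forall>i. i < m \<longrightarrow> f i = {x. g i \<bullet> x \<le> b i}"
    by metis
  then have "P = {x. \<forall>i<m. g i \<bullet> x \<le> b i}"
    unfolding F(2) F_eq by auto
  then show "\<exists>(m::nat) g b. P = {x. \<forall>i<m. g i \<bullet> x \<le> b i}" by blast
next
  assume "\<exists>(m::nat) (g :: nat \<Rightarrow> real^'n) b. P = {x. \<forall>i<m. g i \<bullet> x \<le> b i}"
  then obtain m :: nat and g :: "nat \<Rightarrow> real^'n" and b where P: "P = {x. \<forall>i<m. g i \<bullet> x \<le> b i}"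
    by blast
  have "P = \<Inter>((\<lambda>i. {x. g i \<bullet> x \<le> b i}) ` {..<m})"
    unfolding P by auto
  then show "polyhedron P"
    by (auto intro!: polyhedron_Inter simp: polyhedron_halfspace_le)
qed

text \<open>
  Trajectories are solutions on \<open>[0, \<infinity>)\<close>. The derivative is taken within that set,
  hence one-sided at \<open>t = 0\<close>; values of \<open>x\<close> at negative times are irrelevant.
\<close>

definition solves_linear_ode :: "real^'n^'n \<Rightarrow> (real \<Rightarrow> real^'n) \<Rightarrow> bool" where
  "solves_linear_ode A x \<longleftrightarrow>
     (\<forall>t\<ge>0. (x has_vector_derivative (A *v x t)) (at t within {0..}))"

definition invariant_continuous :: "real^'n^'n \<Rightarrow> (real^'n) set \<Rightarrow> bool" where
  "invariant_continuous A S \<longleftrightarrow>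
     (\<forall>x. solves_linear_ode A x \<longrightarrow> x 0 \<in> S \<longrightarrow> (\<forall>t\<ge>0. x t \<in> S))"

definition invariant_discrete :: "real^'n^'n \<Rightarrow> (real^'n) set \<Rightarrow> bool" where
  "invariant_discrete M S \<longleftrightarrow>
     (\<forall>x :: nat \<Rightarrow> real^'n. (\<forall>k. x (Suc k) = M *v x k) \<longrightarrow>
        (\<forall>k. x k \<in> S \<longrightarrow> x (Suc k) \<in> S))"

definition euler_matrix :: "real^'n^'n \<Rightarrow> real \<Rightarrow> real^'n^'n" where
  "euler_matrix A dt = mat 1 + dt *\<^sub>R A"

end

theory Submission
  imports Defs
begin

text \<open>
  Write \<open>P = {x. \<forall>i<m. g i \<bullet> x \<le> b i}\<close>. An Euler step of length \<open>dt\<close> changes the \<open>i\<close>-th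
  constraint function by \<open>dt * (g i \<bullet> (A *v x))\<close>, so it stays in \<open>P\<close> as soon as this
  increase is at most the slack \<open>b i - g i \<bullet> x\<close>. It therefore suffices to find constants
  \<open>\<mu> i \<ge> 0\<close> with \<open>g i \<bullet> (A *v x) \<le> \<mu> i * (b i - g i \<bullet> x)\<close> for all \<open>x \<in> P\<close>,
  since then every \<open>dt \<ge> 0\<close> with \<open>dt * \<mu> i \<le> 1\<close> for all \<open>i\<close> works, uniformly in \<open>x\<close>. The
  difficulty is that the slack can be arbitrarily small and the velocity, on an unbounded
  \<open>P\<close>, arbitrarily large.

  Invariance gives two sign conditions on the linear functional \<open>h = (\<lambda>x. g i \<bullet> (A *v x))\<close>.
  On the face \<open>g i \<bullet> x = b i\<close> it is nonpositive, since a trajectory starting there would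
  otherwise leave \<open>P\<close> at once (\<open>invariant_velocity_nonpos\<close>). The same holds for recession
  directions \<open>d\<close> of \<open>P\<close> with \<open>g i \<bullet> d = 0\<close>: by linearity of the system the trajectories from
  \<open>x + s d\<close>, divided by \<open>s\<close>, tend to the one from \<open>d\<close>, which thus stays in the recession cone
  (\<open>invariant_recession_velocity_nonpos\<close>).

  Linear programming duality converts these sign conditions into the inequality above
  (\<open>polyhedron_linear_bound\<close>): homogenised by one extra coordinate, they say
  that \<open>(h, 0)\<close> is nonpositive on the polar of a finitely generated cone, so Farkas' lemma
  puts it into that cone, and the inequality is a property inherited from the
  generators. The recession directions are the points at infinity of the homogenisation,
  which is why both conditions enter; when the face is empty, the second one alone carries
  the argument.
\<close>

section \<open>Solutions of linear systems\<close>

lemma summable_exponential_bound: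
  fixes a :: "nat \<Rightarrow> real"
  assumes "\<And>k. \<bar>a k\<bar> \<le> K ^ k * C"
  shows "summable (\<lambda>k. a k / fact k * t ^ k)"
proof (rule summable_comparison_test')
  show "summable (\<lambda>k. C * (inverse (fact k) * (K * \<bar>t\<bar>) ^ k))"
    by (intro summable_mult summable_exp)
  show "norm (a k / fact k * t ^ k) \<le> C * (inverse (fact k) * (K * \<bar>t\<bar>) ^ k)" if "k \<ge> 0" for k
    using mult_right_mono[OF assms[of k], of "inverse (fact k) * \<bar>t\<bar> ^ k"]
    by (simp add: abs_mult power_abs power_mult_distrib divide_inverse mult_ac)
qed

text \<open>
  The solution is the exponential series \<open>\<Sum>k. t^k / k! A^k x0\<close>. Taken coordinatewise it
  consists of real power series, so that the termwise differentiation theorem for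
  these applies and no matrix norm or matrix exponential has to be introduced.
\<close>

lemma solves_linear_ode_exists:
  fixes A :: "real^'n^'n" and x0 :: "real^'n"
  obtains x where "solves_linear_ode A x" and "x 0 = x0"
proof
  define a where "a k = ((*v) A ^^ k) x0" for k
  define x where "x t = (\<chi> i. \<Sum>k. a k $ i / fact k * t ^ k)" for t :: real
  have a_Suc: "a (Suc k) = A *v a k" for k
    by (simp add: a_def)
  have bl: "bounded_linear ((*v) A)"
    by (rule matrix_vector_mul_bounded_linear)
  obtain K where K: "K > 0" "\<And>y. norm (A *v y) \<le> norm y * K"
    using bounded_linear.pos_bounded[OF bl] by blast
  have norm_a: "norm (a k) \<le> K ^ k * norm x0" for k
  proof (induction k)
    case 0
    then show ?case by (simp add: a_def)
  next
    case (Suc k)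
    have "norm (a (Suc k)) \<le> norm (a k) * K"
      using K(2) by (simp add: a_Suc)
    also have "\<dots> \<le> (K ^ k * norm x0) * K"
      using Suc K(1) by (intro mult_right_mono) auto
    finally show ?case by (simp add: mult_ac)
  qed
  have summ: "summable (\<lambda>k. a k $ i / fact k * t ^ k)" for i t
    by (rule summable_exponential_bound[where K = K and C = "norm x0"])
      (use norm_a component_le_norm_cart order_trans in blast)
  have diffs: "diffs (\<lambda>k. a k $ i / fact k) = (\<lambda>k. a (Suc k) $ i / fact k)" for i
    by (auto simp: diffs_def divide_simps)
  have Ax: "(A *v x t) $ i = (\<Sum>k. a (Suc k) $ i / fact k * t ^ k)" for t i
  proof -
    have "(A *v x t) $ i = (\<Sum>j\<in>UNIV. \<Sum>k. A $ i $ j * (a k $ j / fact k * t ^ k))"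
      by (simp only: matrix_vector_mult_def x_def vec_lambda_beta suminf_mult[OF summ])
    also have "\<dots> = (\<Sum>k. \<Sum>j\<in>UNIV. A $ i $ j * (a k $ j / fact k * t ^ k))"
      by (rule suminf_sum[symmetric]) (intro summable_mult summ)
    also have "\<dots> = (\<Sum>k. a (Suc k) $ i / fact k * t ^ k)"
      by (simp add: a_Suc matrix_vector_mult_def sum_divide_distrib sum_distrib_left mult_ac)
    finally show ?thesis .
  qed
  have "((\<lambda>t. x t $ i) has_real_derivative (A *v x t) $ i) (at t)" for i t
    using termdiffs_strong_converges_everywhere[OF summ, of i t]
    unfolding Ax diffs by (simp add: x_def)
  then have "(x has_vector_derivative A *v x t) (at t)" for t
    unfolding has_vector_derivative_def has_derivative_componentwise_within[where f = x]
    by (auto simp: Basis_vec_def inner_axis has_field_derivative_def mult_commute_abs)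
  then show "solves_linear_ode A x"
    unfolding solves_linear_ode_def by (blast intro: has_vector_derivative_at_within)
  show "x 0 = x0"
    by (simp add: x_def a_def vec_eq_iff powser_zero del: times_divide_eq_left)
qed

lemma solves_linear_ode_add_scaleR:
  assumes "solves_linear_ode A u" and "solves_linear_ode A v"
  shows "solves_linear_ode A (\<lambda>t. u t + s *\<^sub>R v t)"
  unfolding solves_linear_ode_def
proof (intro allI impI)
  fix t :: real assume "t \<ge> 0"
  then have "((\<lambda>t. u t + s *\<^sub>R v t) has_vector_derivative A *v u t + s *\<^sub>R (A *v v t)) (at t within {0..})"
    using assms unfolding solves_linear_ode_def
    by (intro has_vector_derivative_add bounded_linear.has_vector_derivative[OF bounded_linear_scaleR_right]) auto
  then show "((\<lambda>t. u t + s *\<^sub>R v t) has_vector_derivative A *v (u t + s *\<^sub>R v t)) (at t within {0..})"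
    by (simp add: matrix_vector_right_distrib matrix_vector_mult_scaleR)
qed

section \<open>Constraints at which a trajectory starts\<close>

lemma inner_velocity_nonpos:
  assumes "solves_linear_ode A x"
    and "\<And>t. t \<ge> 0 \<Longrightarrow> g \<bullet> x t \<le> g \<bullet> x 0"
  shows "g \<bullet> (A *v x 0) \<le> 0"
proof (rule ccontr)
  assume pos: "\<not> g \<bullet> (A *v x 0) \<le> 0"
  have "(x has_vector_derivative A *v x 0) (at 0 within {0..})"
    using assms(1) by (simp add: solves_linear_ode_def)
  then have "((\<lambda>t. g \<bullet> x t) has_real_derivative g \<bullet> (A *v x 0)) (at 0 within {0..})"
    unfolding has_real_derivative_iff_has_vector_derivative
    by (rule bounded_linear.has_vector_derivative[OF bounded_linear_inner_right])
  from has_real_derivative_pos_inc_right[OF this] pos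
  obtain d where d: "d > 0" "\<And>h. h > 0 \<Longrightarrow> h < d \<Longrightarrow> g \<bullet> x 0 < g \<bullet> x h"
    by auto
  show False
    using d(2)[of "d/2"] d(1) assms(2)[of "d/2"] by simp
qed

lemma nonpos_if_ray_bounded:
  fixes p q c :: real
  assumes "\<And>s. s \<ge> 0 \<Longrightarrow> p + s * q \<le> c"
  shows "q \<le> 0"
proof (rule ccontr)
  assume "\<not> q \<le> 0"
  then have "q > 0" by simp
  have "p + ((\<bar>c\<bar> + \<bar>p\<bar> + 1) / q) * q \<le> c"
    using \<open>q > 0\<close> by (intro assms) simp
  then show False
    using \<open>q > 0\<close> by simp
qed

text \<open>The necessity half of Nagumo's theorem, for one supporting halfspace.\<close>

lemma invariant_velocity_nonpos:
  assumes "invariant_continuous A S" and "\<And>y. y \<in> S \<Longrightarrow> g \<bullet> y \<le> c"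
    and "x \<in> S" and "g \<bullet> x = c"
  shows "g \<bullet> (A *v x) \<le> 0"
proof -
  obtain u where u: "solves_linear_ode A u" "u 0 = x"
    by (rule solves_linear_ode_exists)
  then have "u t \<in> S" if "t \<ge> 0" for t
    using assms(1,3) that by (auto simp: invariant_continuous_def)
  then show ?thesis
    using inner_velocity_nonpos[OF u(1), of g] u(2) assms(2,4) by auto
qed

text \<open>
  With \<open>u\<close> and \<open>v\<close> the trajectories from \<open>x\<close> and \<open>d\<close>, superposition makes \<open>u + s v\<close> the
  trajectory from a point of the ray. At each time the bound \<open>g \<bullet> u t + s * (g \<bullet> v t) \<le> c\<close>
  for all \<open>s \<ge> 0\<close> forces \<open>g \<bullet> v t \<le> 0\<close>, and \<open>v\<close> starts with equality.
\<close>

lemma invariant_recession_velocity_nonpos: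
  assumes "invariant_continuous A S" and "\<And>y. y \<in> S \<Longrightarrow> g \<bullet> y \<le> c"
    and ray: "\<And>s. s \<ge> 0 \<Longrightarrow> x + s *\<^sub>R d \<in> S" and "g \<bullet> d = 0"
  shows "g \<bullet> (A *v d) \<le> 0"
proof -
  obtain u where u: "solves_linear_ode A u" "u 0 = x"
    by (rule solves_linear_ode_exists)
  obtain v where v: "solves_linear_ode A v" "v 0 = d"
    by (rule solves_linear_ode_exists)
  have "g \<bullet> v t \<le> 0" if "t \<ge> 0" for t
  proof (rule nonpos_if_ray_bounded)
    fix s :: real assume "s \<ge> 0"
    then have "u t + s *\<^sub>R v t \<in> S"
      using assms(1) solves_linear_ode_add_scaleR[OF u(1) v(1), of s] ray[of s] u(2) v(2) \<open>t \<ge> 0\<close>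
      by (auto simp: invariant_continuous_def)
    then show "g \<bullet> u t + s * (g \<bullet> v t) \<le> c"
      using assms(2) by (fastforce simp: inner_right_distrib)
  qed
  then show ?thesis
    using inner_velocity_nonpos[OF v(1), of g] v(2) assms(4) by auto
qed

section \<open>A linear bound on the velocity across a constraint\<close>

text \<open>
  Farkas' lemma. A finitely generated cone is closed, so a point outside it is strictly
  separated from it. On a cone a linear functional that is bounded below is nonnegative;
  its negative lies in the polar and contradicts the hypothesis.
\<close>

lemma farkas_cone:
  fixes z :: "'a::euclidean_space"
  assumes "finite S" and polar: "\<And>y. (\<And>s. s \<in> S \<Longrightarrow> y \<bullet> s \<le> 0) \<Longrightarrow> y \<bullet> z \<le> 0"
  shows "z \<in> convex_cone hull S"
proof (rule ccontr)
  let ?K = "convex_cone hull S"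
  assume "z \<notin> ?K"
  then obtain a b where ab: "a \<bullet> z < b" "\<And>x. x \<in> ?K \<Longrightarrow> a \<bullet> x > b"
    using separating_hyperplane_closed_point[of ?K z]
    by (metis assms(1) closed_convex_cone_hull convex_convex_cone_hull)
  have "b < 0"
    using ab(2)[OF convex_cone_hull_contains_0] by simp
  have "- a \<bullet> s \<le> 0" if "s \<in> S" for s
  proof (rule nonpos_if_ray_bounded)
    fix r :: real assume "r \<ge> 0"
    then have "r *\<^sub>R s \<in> ?K"
      using that by (simp add: convex_cone_hull_mul hull_inc)
    then show "0 + r * (- a \<bullet> s) \<le> - b"
      using ab(2) by fastforce
  qed
  then have "- a \<bullet> z \<le> 0"
    by (rule polar)
  then show False
    using ab(1) \<open>b < 0\<close> by simp
qed

text \<open>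
  A pair \<open>(c, d)\<close> stands for the affine inequality \<open>c \<bullet> x \<le> d\<close>. The set \<open>K\<close> of those
  inequalities that hold on \<open>P\<close> up to a multiple of the slack of constraint \<open>i\<close> is a
  convex cone, and the claim is \<open>(h, 0) \<in> K\<close>. The generators in \<open>S\<close> are the
  constraints, the reverse of constraint \<open>i\<close> (valid up to one times the slack) and the
  trivial inequality \<open>0 \<le> 1\<close>, so \<open>K\<close> contains the cone over \<open>S\<close>. Arguing with \<open>K\<close> avoids
  writing out the Farkas multipliers.

  An element \<open>(v, r)\<close> of the polar of \<open>S\<close> has \<open>r \<le> 0\<close>. If \<open>r < 0\<close>, then \<open>v / (-r)\<close> is a point of
  the face of constraint \<open>i\<close>; if \<open>r = 0\<close>, then \<open>v\<close> is a recession direction along that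
  constraint. These are the two cases covered by the hypotheses.
\<close>

lemma polyhedron_linear_bound:
  fixes g :: "nat \<Rightarrow> 'a::euclidean_space" and b :: "nat \<Rightarrow> real" and h :: 'a and m :: nat
  defines "P \<equiv> {x. \<forall>k<m. g k \<bullet> x \<le> b k}"
  assumes "i < m"
    and face: "\<And>x. x \<in> P \<Longrightarrow> g i \<bullet> x = b i \<Longrightarrow> h \<bullet> x \<le> 0"
    and recession: "\<And>d. (\<And>k. k < m \<Longrightarrow> g k \<bullet> d \<le> 0) \<Longrightarrow> g i \<bullet> d = 0 \<Longrightarrow> h \<bullet> d \<le> 0"
  obtains \<mu> where "\<mu> \<ge> 0" and "\<And>x. x \<in> P \<Longrightarrow> h \<bullet> x \<le> \<mu> * (b i - g i \<bullet> x)"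
proof -
  define S where "S = insert (0, 1) (insert (- g i, - b i) ((\<lambda>k. (g k, b k)) ` {..<m}))"
  define K where "K = {(c :: 'a, d :: real). \<exists>\<mu>\<ge>0. \<forall>x\<in>P. c \<bullet> x \<le> d + \<mu> * (b i - g i \<bullet> x)}"
  have "(h, 0) \<in> convex_cone hull S"
  proof (rule farkas_cone)
    show "finite S" by (simp add: S_def)
  next
    fix y :: "'a \<times> real"
    assume polar: "\<And>s. s \<in> S \<Longrightarrow> y \<bullet> s \<le> 0"
    obtain v r where y: "y = (v, r)" by fastforce
    have r: "r \<le> 0"
      using polar[of "(0, 1)"] by (simp add: y S_def)
    have k: "g k \<bullet> v + r * b k \<le> 0" if "k < m" for k
      using polar[of "(g k, b k)"] that by (auto simp: y S_def inner_commute)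
    have i: "g i \<bullet> v + r * b i = 0"
      using polar[of "(- g i, - b i)"] k[OF \<open>i < m\<close>] by (auto simp: y S_def inner_commute)
    have "h \<bullet> v \<le> 0"
    proof (cases "r = 0")
      case True
      then show ?thesis using k i by (auto intro: recession)
    next
      case False
      with r have neg: "r < 0" by simp
      define x where "x = (1 / - r) *\<^sub>R v"
      have "x \<in> P"
        unfolding P_def mem_Collect_eq
      proof (intro allI impI)
        show "g k \<bullet> x \<le> b k" if "k < m" for k
          using k[OF that] neg by (simp add: x_def field_simps)
      qed
      moreover have "g i \<bullet> x = b i"
        using i neg by (simp add: x_def field_simps)
      ultimately have "h \<bullet> x \<le> 0" by (rule face)
      then show ?thesis
        using neg by (simp add: x_def field_simps)
    qed
    then show "y \<bullet> (h, 0) \<le> 0"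
      by (simp add: y inner_commute)
  qed
  moreover have "convex_cone hull S \<subseteq> K"
  proof (rule hull_minimal)
    have "(0, 1) \<in> K"
      unfolding K_def by (auto intro!: exI[of _ 0])
    moreover have "(- g i, - b i) \<in> K"
      unfolding K_def by (auto intro!: exI[of _ 1])
    moreover have "(g k, b k) \<in> K" if "k < m" for k
      using that unfolding K_def P_def by (auto intro!: exI[of _ 0])
    ultimately show "S \<subseteq> K"
      by (auto simp: S_def)
    show "convex_cone K"
      unfolding convex_cone_iff
    proof (intro conjI ballI allI impI)
      show "0 \<in> K"
        unfolding K_def zero_prod_def by (auto intro!: exI[of _ 0])
    next
      fix p q assume "p \<in> K" "q \<in> K"
      then obtain \<mu> \<nu> where
        \<mu>: "\<mu> \<ge> 0" "\<And>x. x \<in> P \<Longrightarrow> fst p \<bullet> x \<le> snd p + \<mu> * (b i - g i \<bullet> x)" and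
        \<nu>: "\<nu> \<ge> 0" "\<And>x. x \<in> P \<Longrightarrow> fst q \<bullet> x \<le> snd q + \<nu> * (b i - g i \<bullet> x)"
        by (auto simp: K_def)
      have "fst (p + q) \<bullet> x \<le> snd (p + q) + (\<mu> + \<nu>) * (b i - g i \<bullet> x)" if "x \<in> P" for x
        using add_mono[OF \<mu>(2)[OF that] \<nu>(2)[OF that]]
        by (simp add: inner_left_distrib algebra_simps)
      then show "p + q \<in> K"
        unfolding K_def mem_Collect_eq case_prod_beta using \<mu>(1) \<nu>(1) add_nonneg_nonneg by blast
    next
      fix p and c :: real assume "p \<in> K" "0 \<le> c"
      then obtain \<mu> where
        \<mu>: "\<mu> \<ge> 0" "\<And>x. x \<in> P \<Longrightarrow> fst p \<bullet> x \<le> snd p + \<mu> * (b i - g i \<bullet> x)"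
        by (auto simp: K_def)
      have "fst (c *\<^sub>R p) \<bullet> x \<le> snd (c *\<^sub>R p) + (c * \<mu>) * (b i - g i \<bullet> x)" if "x \<in> P" for x
        using mult_left_mono[OF \<mu>(2)[OF that] \<open>0 \<le> c\<close>] by (simp add: algebra_simps)
      then show "c *\<^sub>R p \<in> K"
        unfolding K_def mem_Collect_eq case_prod_beta using \<mu>(1) \<open>0 \<le> c\<close> mult_nonneg_nonneg by blast
    qed
  qed
  ultimately have "(h, 0) \<in> K" by blast
  then show ?thesis
    using that by (auto simp: K_def)
qed

section \<open>Invariance of Euler steps\<close>

lemma euler_matrix_mult: "euler_matrix A dt *v x = x + dt *\<^sub>R (A *v x)"
  by (simp add: euler_matrix_def matrix_vector_mult_add_rdistrib scaleR_matrix_vector_assoc)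

lemma invariant_discreteI:
  assumes "\<And>x. x \<in> S \<Longrightarrow> M *v x \<in> S"
  shows "invariant_discrete M S"
  using assms by (auto simp: invariant_discrete_def)

theorem theorem4p1:
  fixes A :: "real^'n^'n" and P :: "(real^'n) set"
  assumes "polyhedron P"
    and "invariant_continuous A P"
  shows "\<exists>\<tau>>0. \<forall>dt\<in>{0..\<tau>}.
           (\<forall>x\<in>P. euler_matrix A dt *v x \<in> P) \<and> invariant_discrete (euler_matrix A dt) P"
proof (cases "P = {}")
  case True
  then show ?thesis
    by (auto intro!: exI[of _ 1] invariant_discreteI)
next
  case False
  then obtain x0 where x0: "x0 \<in> P" by blast
  obtain m :: nat and g :: "nat \<Rightarrow> real^'n" and b where P: "P = {x. \<forall>i<m. g i \<bullet> x \<le> b i}"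
    using assms(1) unfolding polyhedron_inequalities by blast
  have "\<exists>\<mu>\<ge>0. \<forall>x\<in>P. g i \<bullet> (A *v x) \<le> \<mu> * (b i - g i \<bullet> x)" if "i < m" for i
  proof -
    have h: "g i \<bullet> (A *v y) = (g i v* A) \<bullet> y" for y
      by (simp add: dot_lmul_matrix)
    have bound: "g i \<bullet> y \<le> b i" if "y \<in> P" for y
      using that \<open>i < m\<close> by (simp add: P)
    obtain \<mu> where "\<mu> \<ge> 0" "\<And>x. x \<in> P \<Longrightarrow> (g i v* A) \<bullet> x \<le> \<mu> * (b i - g i \<bullet> x)"
    proof (rule polyhedron_linear_bound[OF \<open>i < m\<close>, where g = g and b = b, folded P])
      show "(g i v* A) \<bullet> x \<le> 0" if "x \<in> P" "g i \<bullet> x = b i" for x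
        using invariant_velocity_nonpos[OF assms(2) bound that] by (simp add: h)
      show "(g i v* A) \<bullet> d \<le> 0"
        if d: "\<And>k. k < m \<Longrightarrow> g k \<bullet> d \<le> 0" and "g i \<bullet> d = 0" for d
      proof -
        have "x0 + s *\<^sub>R d \<in> P" if "s \<ge> 0" for s
          using x0 mult_nonneg_nonpos[OF that d] unfolding P
          by (fastforce simp: inner_right_distrib)
        from invariant_recession_velocity_nonpos[OF assms(2) bound this] show ?thesis
          using \<open>g i \<bullet> d = 0\<close> by (simp add: h)
      qed
    qed blast
    then show ?thesis by (auto simp: h)
  qed
  then obtain \<mu> where \<mu>: "\<And>i. i < m \<Longrightarrow> \<mu> i \<ge> 0"
    and vel: "\<And>i x. i < m \<Longrightarrow> x \<in> P \<Longrightarrow> g i \<bullet> (A *v x) \<le> \<mu> i * (b i - g i \<bullet> x)"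
    by (metis (no_types))
  \<comment> \<open>The sum bounds every \<open>\<mu> i\<close>; the summand 1 keeps \<open>1 / M\<close> defined when all of them vanish.\<close>
  define M where "M = 1 + (\<Sum>i<m. \<mu> i)"
  have M: "M > 0" "\<And>i. i < m \<Longrightarrow> \<mu> i \<le> M"
    using sum_nonneg[of "{..<m}" \<mu>] member_le_sum[of _ "{..<m}" \<mu>] \<mu>
    by (fastforce simp: M_def)+
  have step: "euler_matrix A dt *v x \<in> P" if dt: "dt \<in> {0..1 / M}" and "x \<in> P" for dt x
  proof -
    have "g i \<bullet> (x + dt *\<^sub>R (A *v x)) \<le> b i" if "i < m" for i
    proof -
      have slack: "0 \<le> b i - g i \<bullet> x"
        using \<open>x \<in> P\<close> \<open>i < m\<close> by (simp add: P)
      have "dt * \<mu> i \<le> dt * M"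
        using dt M(2)[OF \<open>i < m\<close>] by (intro mult_left_mono) auto
      also have "\<dots> \<le> 1"
        using dt M(1) by (simp add: field_simps)
      finally have le1: "dt * \<mu> i \<le> 1" .
      have "dt * (g i \<bullet> (A *v x)) \<le> dt * (\<mu> i * (b i - g i \<bullet> x))"
        using dt vel[OF \<open>i < m\<close> \<open>x \<in> P\<close>] by (intro mult_left_mono) auto
      also have "\<dots> \<le> b i - g i \<bullet> x"
        using mult_right_mono[OF le1 slack] by (simp add: mult.assoc)
      finally show ?thesis by (simp add: inner_right_distrib)
    qed
    then show ?thesis by (simp add: P euler_matrix_mult)
  qed
  show ?thesis
  proof (intro exI conjI ballI)
    show "1 / M > 0" using M(1) by simp
  qed (use step invariant_discreteI in blast)+
qed

end
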